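(* Let $G=(V,E)$ be a graph and let $C\subseteq V$ induce a $5$-cycle in $G$. Then every $X_C=(X_{ij})_{i,j\in C}\in\mathrm{STAB}^2(G_C)$ satisfies $$\sum_{\substack{i,j\in C\\ i<j}}X_{ij}\le 1 .$$
   Context: Graphs are finite, simple and undirected, with vertex set $V=\{1,\dots,n\}$ (so the sum over $i<j$ runs over each unordered pair of distinct vertices once). For $C\subseteq V$, $G_C$ is the subgraph of $G$ induced by $C$. A cycle is a sequence of distinct vertices $i_1,\dots,i_k$ ($k\ge3$) such that consecutive vertices are adjacent and $i_k$ is adjacent to $i_1$; its length is $k$, and it may have chords (further edges between its vertices). A set $C$ induces a $5$-cycle in $G$ if $C$ is the vertex set of a cycle of length $5$ in $G$. For a graph $H$, $\mathcal{S}(H)\subseteq\{0,1\}^{V(H)}$ is the set of incidence vectors of stable sets of $H$ (including the empty set), $\mathcal{S}^2(H)=\{ss^\top : s\in\mathcal{S}(H)\}$, and $\mathrm{STAB}^2(H)=\mathrm{conv}\,\mathcal{S}^2(H)$. *)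

theory Defs
  imports "HOL-Analysis.Analysis" "Graph_Theory.Digraph_Component"
begin

text \<open>
  A finite simple undirected graph is a symmetric loop-free digraph without parallel arcs, i.e.
  the library locale predicate \<open>graph\<close>; \<open>u \<rightarrow>\<^bsub>G\<^esub> v\<close> is adjacency and \<open>G \<restriction> C\<close> is the induced subgraph.
\<close>

definition cycle_vertices :: "('v, 'e) pre_digraph \<Rightarrow> 'v list \<Rightarrow> bool" where
  "cycle_vertices G xs \<longleftrightarrow>
     distinct xs \<and> 3 \<le> length xs \<and> set xs \<subseteq> verts G \<and>
     (\<forall>i. Suc i < length xs \<longrightarrow> xs ! i \<rightarrow>\<^bsub>G\<^esub> xs ! Suc i) \<and> last xs \<rightarrow>\<^bsub>G\<^esub> hd xs"

text \<open>Chords are allowed: \<open>G \<restriction> C\<close> need not itself be a cycle graph.\<close>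

definition induces_cycle :: "('v, 'e) pre_digraph \<Rightarrow> nat \<Rightarrow> 'v set \<Rightarrow> bool" where
  "induces_cycle G k C \<longleftrightarrow> (\<exists>xs. cycle_vertices G xs \<and> length xs = k \<and> set xs = C)"

definition stable_set :: "('v, 'e) pre_digraph \<Rightarrow> 'v set \<Rightarrow> bool" where
  "stable_set H S \<longleftrightarrow> S \<subseteq> verts H \<and> (\<forall>u\<in>S. \<forall>v\<in>S. \<not> u \<rightarrow>\<^bsub>H\<^esub> v)"

text \<open>
  For a graph \<open>H\<close> whose vertex set is a subset of the finite type \<open>'v\<close>, vectors and matrices
  indexed by \<open>verts H\<close> are represented by vectors and matrices indexed by \<open>'v\<close> that vanish
  outside \<open>verts H\<close>. This embedding is linear and injective, so it commutes with convex hulls.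
\<close>

definition incidence_vector :: "'v set \<Rightarrow> real ^ 'v::finite" where
  "incidence_vector S = (\<chi> i. if i \<in> S then 1 else 0)"

definition stable_vectors :: "('v::finite, 'e) pre_digraph \<Rightarrow> (real ^ 'v) set" where
  "stable_vectors H = {incidence_vector S | S. stable_set H S}"

definition stable_matrices :: "('v::finite, 'e) pre_digraph \<Rightarrow> (real ^ 'v ^ 'v) set" where
  "stable_matrices H = {\<chi> i j. s $ i * s $ j | s. s \<in> stable_vectors H}"

definition STAB2 :: "('v::finite, 'e) pre_digraph \<Rightarrow> (real ^ 'v ^ 'v) set" where
  "STAB2 H = convex hull (stable_matrices H)"

end

theory Submission
  imports Defs
begin

text \<open>
  The left-hand side is linear in \<open>X\<close>, so it suffices to bound it on the generators \<open>s s\<^sup>T\<close> of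
  the convex hull. If \<open>s\<close> is the incidence vector of a stable set \<open>S\<close>, the sum counts the
  two-element subsets of \<open>S\<close>. On a cycle of length \<open>k\<close>, the cyclic successors of the members of
  \<open>S\<close> are as many as \<open>S\<close> itself and lie outside \<open>S\<close>, so \<open>2 * card S \<le> k\<close>. For \<open>k = 5\<close> this
  leaves at most two vertices in \<open>S\<close>, hence at most one pair. Chords only restrict stable sets
  further.
\<close>

lemma dominates_induce_subgraph:
  assumes "u \<rightarrow>\<^bsub>G\<^esub> v" "u \<in> C" "v \<in> C"
  shows "u \<rightarrow>\<^bsub>G \<restriction> C\<^esub> v"
  using assms by (auto simp: arcs_ends_def arc_to_ends_def)

lemma cycle_vertices_cyclic_successor:
  assumes "cycle_vertices G xs" "i < length xs"
  shows "xs ! i \<rightarrow>\<^bsub>G\<^esub> xs ! (Suc i mod length xs)"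
proof (cases "Suc i < length xs")
  case True
  then show ?thesis using assms by (simp add: cycle_vertices_def)
next
  case False
  then have i: "Suc i = length xs" using assms(2) by simp
  then have "xs \<noteq> []" by auto
  then have "xs ! i = last xs" "xs ! 0 = hd xs"
    using i by (auto simp: last_conv_nth hd_conv_nth simp flip: i)
  then show ?thesis using assms(1) i by (simp add: cycle_vertices_def)
qed

text \<open>
  Read the stable set as a set \<open>I\<close> of positions on the cycle. Rotation by one position is
  injective and, by stability, moves \<open>I\<close> off itself; so two disjoint sets of the size of \<open>I\<close>
  fit into the \<open>k\<close> positions.
\<close>

lemma card_stable_set_cycle:
  assumes "induces_cycle G k C" "stable_set (G \<restriction> C) S"
  shows "2 * card S \<le> k"
proof -
  obtain xs where xs: "cycle_vertices G xs" "length xs = k" "set xs = C"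
    using assms(1) by (auto simp: induces_cycle_def)
  have k: "0 < k" and dist: "distinct xs" using xs by (auto simp: cycle_vertices_def)
  have SC: "S \<subseteq> C" using assms(2) by (simp add: stable_set_def)
  define I where "I = {i. i < k \<and> xs ! i \<in> S}"
  define r where "r i = Suc i mod k" for i
  have "bij_betw ((!) xs) I S"
    unfolding bij_betw_def
  proof
    show "inj_on ((!) xs) I"
      using dist xs(2) by (auto simp: I_def inj_on_def nth_eq_iff_index_eq)
    show "(!) xs ` I = S"
      using SC xs by (auto simp: I_def image_iff) (metis in_set_conv_nth subsetD)
  qed
  then have card_I: "card I = card S" by (rule bij_betw_same_card)
  have "inj_on r I"
    by (auto simp: inj_on_def r_def I_def mod_Suc split: if_splits)
  then have card_rI: "card (r ` I) = card S" using card_I by (simp add: card_image)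
  have "I \<inter> r ` I = {}"
  proof (rule ccontr)
    assume "I \<inter> r ` I \<noteq> {}"
    then obtain i where i: "i \<in> I" "r i \<in> I" by auto
    then have "xs ! i \<rightarrow>\<^bsub>G\<^esub> xs ! r i"
      using cycle_vertices_cyclic_successor[OF xs(1)] xs(2) by (simp add: I_def r_def)
    then have "xs ! i \<rightarrow>\<^bsub>G \<restriction> C\<^esub> xs ! r i"
      using i SC by (intro dominates_induce_subgraph) (auto simp: I_def)
    then show False using assms(2) i by (auto simp: stable_set_def I_def)
  qed
  moreover have "finite I" by (simp add: I_def)
  ultimately have "card (I \<union> r ` I) = 2 * card S"
    using card_I card_rI by (simp add: card_Un_disjoint)
  moreover have "card (I \<union> r ` I) \<le> card {..<k}"
    using k by (intro card_mono) (auto simp: I_def r_def)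
  ultimately show ?thesis by simp
qed

lemma card_ordered_pairs_le_choose_two:
  fixes S :: "'a::linorder set"
  assumes "finite S"
  shows "card {(i, j). i \<in> S \<and> j \<in> S \<and> i < j} \<le> card S choose 2"
proof -
  let ?P = "{(i, j). i \<in> S \<and> j \<in> S \<and> i < j}"
  have "card ?P \<le> card {B. B \<subseteq> S \<and> card B = 2}"
  proof (rule card_inj_on_le)
    show "inj_on (\<lambda>(i, j). {i, j}) ?P"
      by (auto simp: inj_on_def doubleton_eq_iff)
    show "(\<lambda>(i, j). {i, j}) ` ?P \<subseteq> {B. B \<subseteq> S \<and> card B = 2}"
      by auto
  qed (use assms in simp)
  then show ?thesis using assms by (simp add: n_subsets)
qed

lemma sum_incidence_products:
  fixes C S :: "'v::{finite,linorder} set"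
  assumes "S \<subseteq> C"
  shows "(\<Sum>(i, j) \<in> {(i, j). i \<in> C \<and> j \<in> C \<and> i < j}.
           incidence_vector S $ i * incidence_vector S $ j)
         = real (card {(i, j). i \<in> S \<and> j \<in> S \<and> i < j})" (is "sum ?f ?P = real (card ?Q)")
proof -
  have "sum ?f ?P = (\<Sum>p\<in>?P. if p \<in> ?Q then 1 else 0)"
    by (intro sum.cong) (auto simp: incidence_vector_def split: if_splits)
  also have "\<dots> = (\<Sum>p\<in>?P \<inter> ?Q. 1)" by (rule sum.inter_restrict [symmetric]) simp
  also have "?P \<inter> ?Q = ?Q" using assms by auto
  finally show ?thesis by simp
qed

text \<open>The matrices that satisfy a fixed linear inequality form a half-space, which is convex.\<close>

lemma STAB2_sum_le:
  fixes H :: "('v::finite, 'e) pre_digraph"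
  assumes "X \<in> STAB2 H"
    and stable: "\<And>S. stable_set H S \<Longrightarrow>
      (\<Sum>(i, j) \<in> P. incidence_vector S $ i * incidence_vector S $ j) \<le> b"
  shows "(\<Sum>(i, j) \<in> P. X $ i $ j) \<le> b"
proof -
  let ?L = "\<lambda>X :: real ^ 'v ^ 'v. \<Sum>(i, j) \<in> P. X $ i $ j"
  have "convex {X. ?L X \<le> b}"
  proof (rule convexI, simp only: mem_Collect_eq)
    fix A B :: "real ^ 'v ^ 'v" and u v :: real
    assume le: "?L A \<le> b" "?L B \<le> b" and uv: "0 \<le> u" "0 \<le> v" "u + v = 1"
    have "?L (u *\<^sub>R A + v *\<^sub>R B) = u * ?L A + v * ?L B"
      by (simp add: case_prod_beta sum.distrib sum_distrib_left)
    also have "\<dots> \<le> b" using le uv by (rule convex_bound_le)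
    finally show "?L (u *\<^sub>R A + v *\<^sub>R B) \<le> b" .
  qed
  moreover have "stable_matrices H \<subseteq> {X. ?L X \<le> b}"
    using stable by (auto simp: stable_matrices_def stable_vectors_def)
  ultimately have "STAB2 H \<subseteq> {X. ?L X \<le> b}"
    unfolding STAB2_def by (intro hull_minimal)
  then show ?thesis using assms(1) by auto
qed

theorem corollary7:
  fixes G :: "('v::{finite,linorder}, 'e) pre_digraph"
    and C :: "'v set"
    and X :: "real ^ ('v::{finite,linorder}) ^ ('v::{finite,linorder})"
  assumes "graph G"
    and "C \<subseteq> verts G"
    and "induces_cycle G 5 C"
    and "X \<in> STAB2 (G \<restriction> C)"
  shows "(\<Sum>(i, j) \<in> {(i, j). i \<in> C \<and> j \<in> C \<and> i < j}. X $ i $ j) \<le> 1"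
  using assms(4)
proof (rule STAB2_sum_le)
  fix S assume S: "stable_set (G \<restriction> C) S"
  then have "S \<subseteq> C" by (simp add: stable_set_def)
  have "card S \<le> 2" using card_stable_set_cycle[OF assms(3) S] by simp
  then have "card S choose 2 \<le> 2 choose 2" by (rule binomial_right_mono)
  then have "card {(i, j). i \<in> S \<and> j \<in> S \<and> i < j} \<le> 1"
    using card_ordered_pairs_le_choose_two[of S] by simp
  then show "(\<Sum>(i, j) \<in> {(i, j). i \<in> C \<and> j \<in> C \<and> i < j}.
      incidence_vector S $ i * incidence_vector S $ j) \<le> (1::real)"
    using sum_incidence_products[OF \<open>S \<subseteq> C\<close>] by simp
qed

end
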